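(* The signature $\Sigma_{SETAF}^{\mathit{stb}_{\mathcal L}}=\{\mathit{stb}_{\mathcal L}(F)\mid F\text{ a SETAF}\}$ is given by exactly all sets $\mathbb L$ of labellings such that: 1. all $\lambda\in\mathbb L$ have the same domain $\mathrm{Args}_{\mathbb L}$, and $\lambda(s)\neq\mathrm{undec}$ for all $\lambda\in\mathbb L$ and $s\in\mathrm{Args}_{\mathbb L}$; 2. if $\lambda\in\mathbb L$ assigns one argument to $\mathrm{out}$ then it also assigns an argument to $\mathrm{in}$; 3. for arbitrary $\lambda_1,\lambda_2\in\mathbb L$ with $\lambda_1\neq\lambda_2$ there is an argument $a$ such that $\lambda_1(a)=\mathrm{in}$ and $\lambda_2(a)=\mathrm{out}$.
   Context: A SETAF is a pair $F=(A,R)$ with $A$ a finite set (of arguments) and $R\subseteq(2^A\setminus\{\emptyset\})\times A$. A labelling of $F$ is a total function $\lambda:A\to\{\mathrm{in},\mathrm{out},\mathrm{undec}\}$; $\lambda_x=\{a\in A\mid\lambda(a)=x\}$. In general, a labelling is such a function on some finite set of arguments (its domain). A labelling $\lambda$ is conflict-free in $F$ if (i) for all $(B,a)\in R$, either $\lambda(a)\neq\mathrm{in}$ or there is $b\in B$ with $\lambda(b)\ne\mathrm{in}$; and (ii) for all $a\in A$, if $\lambda(a)=\mathrm{out}$ then there is $(B,a)\in R$ with $\lambda(b)=\mathrm{in}$ for all $b\in B$. A labelling is stable in $F$ iff it is conflict-free in $F$ and $\lambda_{\mathrm{undec}}=\emptyset$. $\mathit{stb}_{\mathcal L}(F)$ is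 the set of all stable labellings of $F$ (it may be empty; the empty set $\mathbb L=\emptyset$ is allowed and satisfies the conditions vacuously). *)

theory Defs
  imports Main
begin

datatype label = In | Out | Undec

text \<open>A SETAF is a pair (A, R) of arguments and collective attacks.\<close>

type_synonym 'a setaf = "'a set \<times> ('a set \<times> 'a) set"

definition is_setaf :: "'a setaf \<Rightarrow> bool" where
  "is_setaf F \<longleftrightarrow> (case F of (A, R) \<Rightarrow> finite A \<and> R \<subseteq> (Pow A - {{}}) \<times> A)"

text \<open>
  A labelling is a total function on a finite set of arguments. It is encoded as a map, with
  that set as its \<^const>\<open>dom\<close>, so two labellings are equal iff they have the same domain and
  agree on it.
\<close>

type_synonym 'a labelling = "'a \<rightharpoonup> label"

definition is_labelling :: "'a labelling \<Rightarrow> bool" where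
  "is_labelling l \<longleftrightarrow> finite (dom l)"

definition labelling_of :: "'a setaf \<Rightarrow> 'a labelling \<Rightarrow> bool" where
  "labelling_of F l \<longleftrightarrow> dom l = fst F"

definition labelled :: "'a labelling \<Rightarrow> label \<Rightarrow> 'a set" where
  "labelled l x = {a. l a = Some x}"

definition conflict_free :: "'a setaf \<Rightarrow> 'a labelling \<Rightarrow> bool" where
  "conflict_free F l \<longleftrightarrow> (case F of (A, R) \<Rightarrow>
     labelling_of F l \<and>
     (\<forall>(B, a) \<in> R. l a \<noteq> Some In \<or> (\<exists>b\<in>B. l b \<noteq> Some In)) \<and>
     (\<forall>a\<in>A. l a = Some Out \<longrightarrow> (\<exists>B. (B, a) \<in> R \<and> (\<forall>b\<in>B. l b = Some In))))"

definition stable :: "'a setaf \<Rightarrow> 'a labelling \<Rightarrow> bool" where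
  "stable F l \<longleftrightarrow> conflict_free F l \<and> labelled l Undec = {}"

definition stb :: "'a setaf \<Rightarrow> 'a labelling set" where
  "stb F = {l. stable F l}"

definition stb_signature :: "'a labelling set set" where
  "stb_signature = {stb F | F. is_setaf F}"

text \<open>For a set of labellings with a common domain this is that domain.\<close>

definition Args :: "'a labelling set \<Rightarrow> 'a set" where
  "Args L = (\<Union>l\<in>L. dom l)"

end

theory Submission
  imports Defs
begin

text \<open>
  Two stable labellings whose sets of In-labelled arguments are nested coincide, which is
  condition 3. Conversely, a nonempty set of labellings is realised by letting the In-set of every
  labelling attack each of the arguments which that labelling puts Out; the empty set is realised
  by a single self-attacking argument.
\<close>

lemma stable_cases:
  assumes "stable (A, R) l" and "a \<in> A"
  obtains "l a = Some In" | "l a = Some Out"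
proof -
  obtain x where x: "l a = Some x"
    using assms by (auto simp: stable_def conflict_free_def labelling_of_def)
  have "x \<noteq> Undec"
    using assms(1) x by (auto simp: stable_def labelled_def)
  then show thesis
    using x that by (cases x) auto
qed

lemma stable_dom: "stable (A, R) l \<Longrightarrow> dom l = A"
  by (simp add: stable_def conflict_free_def labelling_of_def)

lemma stable_attack:
  "stable (A, R) l \<Longrightarrow> (B, a) \<in> R \<Longrightarrow> \<forall>b\<in>B. l b = Some In \<Longrightarrow> l a \<noteq> Some In"
  by (auto simp: stable_def conflict_free_def)

lemma stable_attacked:
  assumes "stable (A, R) l" and "l a = Some Out"
  obtains B where "(B, a) \<in> R" and "\<forall>b\<in>B. l b = Some In"
proof -
  have "a \<in> A"
    using assms stable_dom by fastforce
  then show thesis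
    using assms that by (auto simp: stable_def conflict_free_def)
qed

lemma stable_no_undec: "stable F l \<Longrightarrow> l a \<noteq> Some Undec"
  by (auto simp: stable_def labelled_def)

lemma stableI:
  assumes "dom l = A" and "\<And>a. l a \<noteq> Some Undec"
    and "\<And>B a. (B, a) \<in> R \<Longrightarrow> l a = Some In \<Longrightarrow> \<exists>b\<in>B. l b \<noteq> Some In"
    and "\<And>a. l a = Some Out \<Longrightarrow> \<exists>B. (B, a) \<in> R \<and> (\<forall>b\<in>B. l b = Some In)"
  shows "stable (A, R) l"
  using assms unfolding stable_def conflict_free_def labelling_of_def labelled_def by auto

text \<open>An argument that is Out in \<open>l1\<close> is attacked by a set that is In under
  \<open>l1\<close>, hence also under \<open>l2\<close>, so it cannot be In in \<open>l2\<close>.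
  With Undec excluded it is Out there too.\<close>

lemma stable_eqI:
  assumes "stable (A, R) l1" and "stable (A, R) l2"
    and in_sub: "\<And>a. l1 a = Some In \<Longrightarrow> l2 a = Some In"
  shows "l1 = l2"
proof
  fix a
  show "l1 a = l2 a"
  proof (cases "a \<in> A")
    case False
    then show ?thesis
      using assms(1,2)[THEN stable_dom] by (metis domIff)
  next
    case True
    from assms(1) True show ?thesis
    proof (cases rule: stable_cases)
      case 1
      then show ?thesis
        using in_sub by simp
    next
      case 2
      obtain B where "(B, a) \<in> R" and "\<forall>b\<in>B. l1 b = Some In"
        using stable_attacked[OF assms(1) 2] .
      then have "l2 a \<noteq> Some In"
        using stable_attack[OF assms(2)] in_sub by blast
      then show ?thesis
        using 2 stable_cases[OF assms(2) True] by metis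
    qed
  qed
qed

text \<open>By the contrapositive of \<open>stable_eqI\<close>, some argument is In in
  \<open>l1\<close> but not in \<open>l2\<close>. Having no Undec, \<open>l2\<close> must put it
  Out.\<close>

lemma stable_differ:
  assumes "stable (A, R) l1" and "stable (A, R) l2" and "l1 \<noteq> l2"
  shows "\<exists>a. l1 a = Some In \<and> l2 a = Some Out"
proof -
  obtain a where a: "l1 a = Some In" "l2 a \<noteq> Some In"
    using stable_eqI assms by blast
  then have "a \<in> A"
    using stable_dom[OF assms(1)] by blast
  then show ?thesis
    using a stable_cases[OF assms(2)] by metis
qed

lemma stable_out_imp_in:
  assumes "is_setaf (A, R)" and "stable (A, R) l" and "l a = Some Out"
  shows "\<exists>b. l b = Some In"
proof -
  obtain B where "(B, a) \<in> R" and B: "\<forall>b\<in>B. l b = Some In"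
    using stable_attacked[OF assms(2,3)] .
  then have "B \<noteq> {}"
    using assms(1) by (auto simp: is_setaf_def)
  then show ?thesis
    using B by blast
qed

text \<open>This case needs its own witness: for empty \<open>L\<close> the canonical framework has
  no arguments, and then the empty map is stable. Here \<open>x\<close> cannot be In, as it attacks
  itself, nor Out, as its only attacker is \<open>{x}\<close>.\<close>

lemma stb_empty_in_signature: "({} :: 'a labelling set) \<in> stb_signature"
proof -
  fix x :: 'a
  let ?F = "({x}, {({x}, x)})"
  have "\<not> stable ?F l" for l
  proof
    assume l: "stable ?F l"
    then have "l x \<noteq> Some In"
      using stable_attack[OF l, of "{x}" x] by auto
    moreover have "l x \<noteq> Some Out"
      using stable_attacked[OF l, of x] by fastforce
    ultimately show False
      using stable_cases[OF l, of x] by auto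
  qed
  then have "stb ?F = {}"
    by (simp add: stb_def)
  moreover have "is_setaf ?F"
    by (simp add: is_setaf_def)
  ultimately show ?thesis
    unfolding stb_signature_def by blast
qed

text \<open>Members of \<open>L\<close> are stable because \<open>differ\<close> keeps the attacks
  of one member from firing under another. Conversely, every stable labelling has an In-set
  containing that of some member, and \<open>stable_eqI\<close> identifies the two.\<close>

lemma stb_canonical:
  assumes "L \<noteq> {}"
    and dom: "\<And>l. l \<in> L \<Longrightarrow> dom l = A"
    and no_undec: "\<And>l a. l \<in> L \<Longrightarrow> l a \<noteq> Some Undec"
    and differ: "\<And>l1 l2. l1 \<in> L \<Longrightarrow> l2 \<in> L \<Longrightarrow> l1 \<noteq> l2 \<Longrightarrow> \<exists>a. l1 a = Some In \<and> l2 a = Some Out"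
  shows "stb (A, {(labelled l In, a) | l a. l \<in> L \<and> l a = Some Out}) = L" (is "stb (A, ?R) = L")
proof -
  have L_stable: "stable (A, ?R) l" if l: "l \<in> L" for l
  proof (rule stableI)
    show "\<exists>b\<in>B. l b \<noteq> Some In" if attack: "(B, a) \<in> ?R" and a: "l a = Some In" for B a
    proof -
      obtain l' where l': "l' \<in> L" "l' a = Some Out" and B: "B = labelled l' In"
        using attack by blast
      \<comment> \<open>\<open>l'\<close> differs from \<open>l\<close> since they disagree on
        \<open>a\<close>. The order of arguments to \<open>differ\<close> matters: \<open>b\<close>
        must lie in the attacking In-set of \<open>l'\<close> and be Out in
        \<open>l\<close>.\<close>
      then obtain b where "l' b = Some In" "l b = Some Out"
        using differ[of l' l] l a by fastforce
      then show ?thesis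
        by (auto simp: B labelled_def)
    qed
    show "\<exists>B. (B, a) \<in> ?R \<and> (\<forall>b\<in>B. l b = Some In)" if "l a = Some Out" for a
    proof (intro exI conjI)
      show "(labelled l In, a) \<in> ?R"
        using that l by blast
    qed (simp add: labelled_def)
  qed (use l dom no_undec in auto)
  have "l \<in> L" if l: "stable (A, ?R) l" for l
  proof -
    have "\<exists>l'\<in>L. \<forall>b. l' b = Some In \<longrightarrow> l b = Some In"
    proof (cases "\<exists>a. l a = Some Out")
      \<comment> \<open>The attack that justifies an Out argument comes from the In-set of some
        member of \<open>L\<close>.\<close>
      case True
      then obtain a where "l a = Some Out" ..
      then obtain B where "(B, a) \<in> ?R" "\<forall>b\<in>B. l b = Some In"
        by (rule stable_attacked[OF l])
      then show ?thesis
        by (auto simp: labelled_def)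
    next
      \<comment> \<open>With nothing Out, all of \<open>A\<close> is In under \<open>l\<close>, so
        any member of \<open>L\<close> will do.\<close>
      case False
      have "l a = Some In" if "a \<in> A" for a
        using l that by (rule stable_cases) (use False in auto)
      then show ?thesis
        using \<open>L \<noteq> {}\<close> dom by blast
    qed
    then obtain l' where "l' \<in> L" "\<And>b. l' b = Some In \<Longrightarrow> l b = Some In"
      by blast
    then show ?thesis
      using stable_eqI[OF L_stable l] by blast
  qed
  then show ?thesis
    using L_stable unfolding stb_def by blast
qed

theorem proposition3:
  "(stb_signature :: 'a labelling set set) =
     {L. (\<forall>l\<in>L. is_labelling l) \<and>
         (\<forall>l\<in>L. dom l = Args L \<and> (\<forall>s\<in>Args L. l s \<noteq> Some Undec)) \<and>
         (\<forall>l\<in>L. (\<exists>a. l a = Some Out) \<longrightarrow> (\<exists>a. l a = Some In)) \<and>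
         (\<forall>l1\<in>L. \<forall>l2\<in>L. l1 \<noteq> l2 \<longrightarrow> (\<exists>a. l1 a = Some In \<and> l2 a = Some Out))}"
  (is "_ = {L. ?P L}")
proof (intro equalityI subsetI CollectI)
  fix L :: "'a labelling set"
  assume "L \<in> stb_signature"
  then obtain A R where F: "is_setaf (A, R)" and L: "L = stb (A, R)"
    by (auto simp: stb_signature_def)
  have mem: "stable (A, R) l" if "l \<in> L" for l
    using that by (simp add: L stb_def)
  \<comment> \<open>Stated relative to a member, since \<open>Args {}\<close> is empty whatever
    \<open>A\<close> is.\<close>
  have "Args L = A" if "l \<in> L" for l
    using that stable_dom[OF mem] by (auto simp: Args_def)
  moreover have "finite A"
    using F by (simp add: is_setaf_def)
  ultimately show "?P L"
    using stable_dom[OF mem] stable_no_undec[OF mem] stable_out_imp_in[OF F mem]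
      stable_differ[OF mem mem]
    by (auto simp: is_labelling_def)
next
  fix L :: "'a labelling set"
  assume "L \<in> {L. ?P L}"
  then have P: "?P L" ..
  show "L \<in> stb_signature"
  proof (cases "L = {}")
    case True
    then show ?thesis
      using stb_empty_in_signature by simp
  next
    case False
    let ?R = "{(labelled l In, a) | l a. l \<in> L \<and> l a = Some Out}"
    have "l a \<noteq> Some Undec" if "l \<in> L" for l a
      using P that by (metis domI)
    then have "stb (Args L, ?R) = L"
      using False P by (intro stb_canonical) auto
    moreover have "is_setaf (Args L, ?R)"
    proof -
      have "finite (Args L)"
        using False P by (metis all_not_in_conv is_labelling_def)
      \<comment> \<open>Condition 2 enters here: the attackers are nonempty because a labelling with
        an Out argument also has an In argument.\<close>
      moreover have "labelled l In \<in> Pow (Args L) - {{}}" "a \<in> Args L"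
        if "l \<in> L" "l a = Some Out" for l a
      proof -
        have "\<exists>b. l b = Some In"
          using P that by blast
        moreover have "dom l \<subseteq> Args L"
          using that by (auto simp: Args_def)
        ultimately show "labelled l In \<in> Pow (Args L) - {{}}" "a \<in> Args L"
          using that by (auto simp: labelled_def)
      qed
      ultimately show ?thesis
        unfolding is_setaf_def by (simp add: subset_iff) blast
    qed
    ultimately show ?thesis
      unfolding stb_signature_def by blast
  qed
qed

end
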